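(* Let $M$ be a metric space such that $\mathrm{lip}_0(M)$ is $C$-norming for some $C\ge 1$, that is, $$\forall\gamma\in\mathcal{F}(M),\qquad \|\gamma\|\le C\sup_{f\in B_{\mathrm{lip}_0(M)}}|\langle f,\gamma\rangle| .$$ Then $\mathcal{F}(M)$ has the Schur property.
   Context: All metric spaces come with a distinguished base point $0$. $\mathrm{Lip}_0(M)$ is the Banach space of real-valued Lipschitz functions $f$ on $M$ with $f(0)=0$, normed by the best Lipschitz constant $\|f\|_L$. For $x\in M$ let $\delta(x)\in\mathrm{Lip}_0(M)^*$ be $\delta(x)(f)=f(x)$. The Lipschitz-free space is $\mathcal{F}(M)=\overline{\operatorname{span}}\{\delta(x):x\in M\}\subset\mathrm{Lip}_0(M)^*$ (norm closure); $\langle f,\gamma\rangle$ is the evaluation of $\gamma\in\mathcal{F}(M)$ at $f\in\mathrm{Lip}_0(M)$. $$\mathrm{lip}_0(M)=\Big\{f\in\mathrm{Lip}_0(M):\ \lim_{\varepsilon\to0}\ \sup_{0<d(x,y)<\varepsilon}\frac{|f(x)-f(y)|}{d(x,y)}=0\Big\}$$ and $B_{\mathrm{lip}_0(M)}=\{f\in\mathrm{lip}_0(M):\|f\|_L\le1\}$. A Banach space has the Schur property if every weakly null sequence in it converges to $0$ in norm. *)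

theory Defs
  imports "HOL-Analysis.Analysis"
begin

class pointed_metric_space = metric_space +
  fixes basepoint :: 'a

section \<open>The space of Lipschitz functions vanishing at the base point\<close>

typedef (overloaded) 'a lip0 =
  "{f :: 'a::pointed_metric_space \<Rightarrow> real. f basepoint = 0 \<and> (\<exists>L. L-lipschitz_on UNIV f)}"
  morphisms lip0_apply Abs_lip0
  by (rule exI[of _ "\<lambda>_. 0"]) (auto intro: lipschitz_intros)

text \<open>Note that \<^term>\<open>L-lipschitz_on UNIV f\<close> includes \<^term>\<open>0 \<le> L\<close>.\<close>

definition best_lipschitz :: "('a::metric_space \<Rightarrow> real) \<Rightarrow> real" where
  "best_lipschitz f = Inf {L. L-lipschitz_on UNIV f}"

lemma lip0_apply_basepoint [simp]: "lip0_apply f basepoint = 0"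
  using lip0_apply[of f] by simp

lemma lip0_apply_lipschitz: "\<exists>L. L-lipschitz_on UNIV (lip0_apply f)"
  using lip0_apply[of f] by simp

lemma lip0_eqI: "(\<And>x. lip0_apply f x = lip0_apply g x) \<Longrightarrow> f = g"
  by (metis ext lip0_apply_inject)

lemma best_lipschitz_lipschitz:
  assumes "L-lipschitz_on UNIV f"
  shows "(best_lipschitz f)-lipschitz_on UNIV f"
proof (rule lipschitz_onI)
  have ne: "{L. L-lipschitz_on UNIV f} \<noteq> {}"
    using assms by blast
  show "0 \<le> best_lipschitz f"
    unfolding best_lipschitz_def
    by (rule cInf_greatest[OF ne]) (auto dest: lipschitz_on_nonneg)
  show "dist (f x) (f y) \<le> best_lipschitz f * dist x y" for x y
  proof (cases "x = y")
    case False
    then have d: "dist x y > 0" by simp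
    have "dist (f x) (f y) / dist x y \<le> best_lipschitz f"
      unfolding best_lipschitz_def
    proof (rule cInf_greatest[OF ne])
      fix K assume "K \<in> {L. L-lipschitz_on UNIV f}"
      then have "dist (f x) (f y) \<le> K * dist x y"
        by (auto dest: lipschitz_onD)
      then show "dist (f x) (f y) / dist x y \<le> K"
        using d by (simp add: pos_divide_le_eq)
    qed
    then show ?thesis using d by (simp add: pos_divide_le_eq)
  qed simp
qed

lemma best_lipschitz_le: "L-lipschitz_on UNIV f \<Longrightarrow> best_lipschitz f \<le> L"
  unfolding best_lipschitz_def
  by (rule cInf_lower) (auto intro!: bdd_belowI[where m = 0] dest: lipschitz_on_nonneg)

instantiation lip0 :: (pointed_metric_space) real_normed_vector
begin

definition "0 = Abs_lip0 (\<lambda>_. 0)"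
definition "f + g = Abs_lip0 (\<lambda>x. lip0_apply f x + lip0_apply g x)"
definition "f - g = Abs_lip0 (\<lambda>x. lip0_apply f x - lip0_apply g x)"
definition "- f = Abs_lip0 (\<lambda>x. - lip0_apply f x)"
definition "c *\<^sub>R f = Abs_lip0 (\<lambda>x. c * lip0_apply f x)"
definition "norm f = best_lipschitz (lip0_apply f)"
definition "dist f g = norm (f - g)" for f g :: "'a lip0"
definition "sgn f = inverse (norm f) *\<^sub>R f" for f :: "'a lip0"
definition "uniformity = (INF e\<in>{0<..}. principal {(f, g :: 'a lip0). dist f g < e})"
definition "open U \<longleftrightarrow> (\<forall>f\<in>U. \<forall>\<^sub>F (f', g) in uniformity. f' = f \<longrightarrow> g \<in> U)" for U :: "'a lip0 set"

lemma lip0_apply_zero [simp]: "lip0_apply 0 x = 0"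
  unfolding zero_lip0_def
  by (subst Abs_lip0_inverse) (auto intro: lipschitz_intros)

lemma lip0_apply_add [simp]: "lip0_apply (f + g) x = lip0_apply f x + lip0_apply g x"
  unfolding plus_lip0_def
  using lip0_apply_lipschitz[of f] lip0_apply_lipschitz[of g]
  by (subst Abs_lip0_inverse) (auto intro: lipschitz_on_add)

lemma lip0_apply_diff [simp]: "lip0_apply (f - g) x = lip0_apply f x - lip0_apply g x"
  unfolding minus_lip0_def
  using lip0_apply_lipschitz[of f] lip0_apply_lipschitz[of g]
  by (subst Abs_lip0_inverse) (auto intro: lipschitz_on_diff)

lemma lip0_apply_uminus [simp]: "lip0_apply (- f) x = - lip0_apply f x"
  unfolding uminus_lip0_def
  using lip0_apply_lipschitz[of f]
  by (subst Abs_lip0_inverse) (auto intro: lipschitz_on_minus)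

lemma lip0_apply_scaleR [simp]: "lip0_apply (c *\<^sub>R f) x = c * lip0_apply f x"
  unfolding scaleR_lip0_def
  using lip0_apply_lipschitz[of f]
  by (subst Abs_lip0_inverse) (auto intro: lipschitz_on_cmult_real)

lemma lip0_norm_lipschitz: "(norm f)-lipschitz_on UNIV (lip0_apply f)"
  unfolding norm_lip0_def using best_lipschitz_lipschitz lip0_apply_lipschitz by blast

lemma lip0_norm_le: "L-lipschitz_on UNIV (lip0_apply f) \<Longrightarrow> norm f \<le> L"
  unfolding norm_lip0_def by (rule best_lipschitz_le)

lemma lip0_norm_nonneg: "0 \<le> norm f" for f :: "'a lip0"
  using lip0_norm_lipschitz lipschitz_on_nonneg by blast

lemma lip0_norm_scaleR_le: "norm (c *\<^sub>R f) \<le> \<bar>c\<bar> * norm f" for f :: "'a lip0"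
proof (rule lip0_norm_le)
  have "lip0_apply (c *\<^sub>R f) = (\<lambda>x. c * lip0_apply f x)" by auto
  then show "(\<bar>c\<bar> * norm f)-lipschitz_on UNIV (lip0_apply (c *\<^sub>R f))"
    using lipschitz_on_cmult_real[OF lip0_norm_lipschitz] by auto
qed

instance
proof
  fix f g h :: "'a lip0" and a b :: real
  show "f + g + h = f + (g + h)" "f + g = g + f" "0 + f = f" "- f + f = 0" "f - g = f + - g"
    "a *\<^sub>R (f + g) = a *\<^sub>R f + a *\<^sub>R g" "(a + b) *\<^sub>R f = a *\<^sub>R f + b *\<^sub>R f"
    "a *\<^sub>R b *\<^sub>R f = (a * b) *\<^sub>R f" "1 *\<^sub>R f = f"
    by (auto intro!: lip0_eqI simp: algebra_simps)
  show "dist f g = norm (f - g)" by (rule dist_lip0_def)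
  show "sgn f = inverse (norm f) *\<^sub>R f" by (rule sgn_lip0_def)
  show "uniformity = (INF e\<in>{0<..}. principal {(f, g :: 'a lip0). dist f g < e})"
    by (rule uniformity_lip0_def)
  show "open U \<longleftrightarrow> (\<forall>f\<in>U. \<forall>\<^sub>F (f', g) in uniformity. f' = f \<longrightarrow> g \<in> U)"
    for U :: "'a lip0 set"
    by (rule open_lip0_def)
  show "norm f = 0 \<longleftrightarrow> f = 0"
  proof
    assume 0: "norm f = 0"
    have "lip0_apply f x = 0" for x
      using lipschitz_onD[OF lip0_norm_lipschitz[of f], of x basepoint] 0 by simp
    then show "f = 0" by (intro lip0_eqI) simp
  next
    assume "f = 0"
    then have "0-lipschitz_on UNIV (lip0_apply f)" by (auto intro: lipschitz_onI)
    then show "norm f = 0" using lip0_norm_le lip0_norm_nonneg[of f] by fastforce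
  qed
  show "norm (f + g) \<le> norm f + norm g"
  proof (rule lip0_norm_le)
    have "lip0_apply (f + g) = (\<lambda>x. lip0_apply f x + lip0_apply g x)" by auto
    then show "(norm f + norm g)-lipschitz_on UNIV (lip0_apply (f + g))"
      using lipschitz_on_add[OF lip0_norm_lipschitz lip0_norm_lipschitz] by metis
  qed
  show "norm (a *\<^sub>R f) = \<bar>a\<bar> * norm f"
  proof (rule antisym[OF lip0_norm_scaleR_le])
    show "\<bar>a\<bar> * norm f \<le> norm (a *\<^sub>R f)"
    proof (cases "a = 0")
      case False
      have "f = inverse a *\<^sub>R (a *\<^sub>R f)" using False by (intro lip0_eqI) simp
      then have "norm f \<le> \<bar>inverse a\<bar> * norm (a *\<^sub>R f)"
        using lip0_norm_scaleR_le by metis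
      then show ?thesis using False by (simp add: field_simps)
    qed (simp add: lip0_norm_nonneg)
  qed
qed

end

section \<open>The Lipschitz-free space\<close>

definition lip_delta :: "'a::pointed_metric_space \<Rightarrow> 'a lip0 \<Rightarrow>\<^sub>L real" where
  "lip_delta x = Blinfun (\<lambda>f. lip0_apply f x)"

lemma lip_delta_apply [simp]: "blinfun_apply (lip_delta x) f = lip0_apply f x"
proof -
  have "bounded_linear (\<lambda>f. lip0_apply f x)"
  proof (rule bounded_linear_intro)
    show "norm (lip0_apply f x) \<le> norm f * dist x basepoint" for f
      using lipschitz_onD[OF lip0_norm_lipschitz[of f], of x basepoint] by simp
  qed simp_all
  then show ?thesis by (simp add: lip_delta_def bounded_linear_Blinfun_apply)
qed

typedef (overloaded) 'a lip_free =
  "closure (span (range (lip_delta :: 'a::pointed_metric_space \<Rightarrow> _)))"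
  morphisms lip_free_functional Abs_lip_free
  using span_zero closure_subset by blast

lemma subspace_lip_free:
  "subspace (closure (span (range (lip_delta :: 'a::pointed_metric_space \<Rightarrow> _))))"
proof (rule subspaceI)
  let ?S = "span (range (lip_delta :: 'a \<Rightarrow> _))"
  show "0 \<in> closure ?S" using span_zero closure_subset by blast
  fix \<phi> assume "\<phi> \<in> closure ?S"
  then obtain X where X: "\<And>n. X n \<in> ?S" "X \<longlonglongrightarrow> \<phi>"
    unfolding closure_sequential by blast
  show "c *\<^sub>R \<phi> \<in> closure ?S" for c
    unfolding closure_sequential using X
    by (intro exI[of _ "\<lambda>n. c *\<^sub>R X n"]) (auto intro: tendsto_intros span_scale)
  fix \<psi> assume "\<psi> \<in> closure ?S"
  then obtain Y where Y: "\<And>n. Y n \<in> ?S" "Y \<longlonglongrightarrow> \<psi>"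
    unfolding closure_sequential by blast
  show "\<phi> + \<psi> \<in> closure ?S"
    unfolding closure_sequential using X Y
    by (intro exI[of _ "\<lambda>n. X n + Y n"]) (auto intro: tendsto_intros span_add)
qed

lemma lip_free_eqI: "lip_free_functional \<gamma> = lip_free_functional \<eta> \<Longrightarrow> \<gamma> = \<eta>"
  by (simp add: lip_free_functional_inject)

instantiation lip_free :: (pointed_metric_space) real_normed_vector
begin

definition "0 = Abs_lip_free 0"
definition "\<gamma> + \<eta> = Abs_lip_free (lip_free_functional \<gamma> + lip_free_functional \<eta>)"
definition "\<gamma> - \<eta> = Abs_lip_free (lip_free_functional \<gamma> - lip_free_functional \<eta>)"
definition "- \<gamma> = Abs_lip_free (- lip_free_functional \<gamma>)"
definition "c *\<^sub>R \<gamma> = Abs_lip_free (c *\<^sub>R lip_free_functional \<gamma>)"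
definition "norm \<gamma> = norm (lip_free_functional \<gamma>)"
definition "dist \<gamma> \<eta> = norm (\<gamma> - \<eta>)" for \<gamma> \<eta> :: "'a lip_free"
definition "sgn \<gamma> = inverse (norm \<gamma>) *\<^sub>R \<gamma>" for \<gamma> :: "'a lip_free"
definition "uniformity = (INF e\<in>{0<..}. principal {(\<gamma>, \<eta> :: 'a lip_free). dist \<gamma> \<eta> < e})"
definition "open U \<longleftrightarrow> (\<forall>\<gamma>\<in>U. \<forall>\<^sub>F (\<gamma>', \<eta>) in uniformity. \<gamma>' = \<gamma> \<longrightarrow> \<eta> \<in> U)"
  for U :: "'a lip_free set"

lemma lip_free_functional_zero [simp]: "lip_free_functional 0 = 0"
  unfolding zero_lip_free_def
  by (rule Abs_lip_free_inverse) (rule subspace_0[OF subspace_lip_free])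

lemma lip_free_functional_add [simp]:
  "lip_free_functional (\<gamma> + \<eta>) = lip_free_functional \<gamma> + lip_free_functional \<eta>"
  unfolding plus_lip_free_def
  by (intro Abs_lip_free_inverse subspace_add[OF subspace_lip_free] lip_free_functional)

lemma lip_free_functional_diff [simp]:
  "lip_free_functional (\<gamma> - \<eta>) = lip_free_functional \<gamma> - lip_free_functional \<eta>"
  unfolding minus_lip_free_def
  by (intro Abs_lip_free_inverse subspace_diff[OF subspace_lip_free] lip_free_functional)

lemma lip_free_functional_uminus [simp]:
  "lip_free_functional (- \<gamma>) = - lip_free_functional \<gamma>"
  unfolding uminus_lip_free_def
  by (intro Abs_lip_free_inverse subspace_neg[OF subspace_lip_free] lip_free_functional)

lemma lip_free_functional_scaleR [simp]:
  "lip_free_functional (c *\<^sub>R \<gamma>) = c *\<^sub>R lip_free_functional \<gamma>"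
  unfolding scaleR_lip_free_def
  by (intro Abs_lip_free_inverse subspace_scale[OF subspace_lip_free] lip_free_functional)

instance
proof
  fix \<gamma> \<eta> \<theta> :: "'a lip_free" and a b :: real
  show "\<gamma> + \<eta> + \<theta> = \<gamma> + (\<eta> + \<theta>)" "\<gamma> + \<eta> = \<eta> + \<gamma>" "0 + \<gamma> = \<gamma>" "- \<gamma> + \<gamma> = 0"
    "\<gamma> - \<eta> = \<gamma> + - \<eta>"
    "a *\<^sub>R (\<gamma> + \<eta>) = a *\<^sub>R \<gamma> + a *\<^sub>R \<eta>" "(a + b) *\<^sub>R \<gamma> = a *\<^sub>R \<gamma> + b *\<^sub>R \<gamma>"
    "a *\<^sub>R b *\<^sub>R \<gamma> = (a * b) *\<^sub>R \<gamma>" "1 *\<^sub>R \<gamma> = \<gamma>"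
    by (auto intro!: lip_free_eqI simp: algebra_simps)
  show "dist \<gamma> \<eta> = norm (\<gamma> - \<eta>)" by (rule dist_lip_free_def)
  show "sgn \<gamma> = inverse (norm \<gamma>) *\<^sub>R \<gamma>" by (rule sgn_lip_free_def)
  show "uniformity = (INF e\<in>{0<..}. principal {(\<gamma>, \<eta> :: 'a lip_free). dist \<gamma> \<eta> < e})"
    by (rule uniformity_lip_free_def)
  show "open U \<longleftrightarrow> (\<forall>\<gamma>\<in>U. \<forall>\<^sub>F (\<gamma>', \<eta>) in uniformity. \<gamma>' = \<gamma> \<longrightarrow> \<eta> \<in> U)"
    for U :: "'a lip_free set"
    by (rule open_lip_free_def)
  show "norm \<gamma> = 0 \<longleftrightarrow> \<gamma> = 0"
    unfolding norm_lip_free_def by (metis lip_free_eqI lip_free_functional_zero norm_eq_zero)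
  show "norm (\<gamma> + \<eta>) \<le> norm \<gamma> + norm \<eta>"
    by (simp add: norm_lip_free_def norm_triangle_ineq)
  show "norm (a *\<^sub>R \<gamma>) = \<bar>a\<bar> * norm \<gamma>"
    by (simp add: norm_lip_free_def)
qed

end

lemma dist_lip_free_functional:
  "dist (lip_free_functional \<gamma>) (lip_free_functional \<eta>) = dist \<gamma> \<eta>"
  by (simp add: dist_norm norm_lip_free_def)

instance lip_free :: (pointed_metric_space) banach
proof
  fix X :: "nat \<Rightarrow> 'a lip_free"
  assume "Cauchy X"
  then have "Cauchy (\<lambda>n. lip_free_functional (X n))"
    by (simp add: Cauchy_def dist_lip_free_functional)
  then obtain \<phi> where \<phi>: "(\<lambda>n. lip_free_functional (X n)) \<longlonglongrightarrow> \<phi>"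
    using Cauchy_convergent convergent_def by blast
  then have "\<phi> \<in> closure (span (range lip_delta))"
    by (rule closed_sequentially[OF closed_closure, rotated]) (rule lip_free_functional)
  then obtain \<gamma> where "\<phi> = lip_free_functional \<gamma>"
    by (metis Abs_lip_free_inverse)
  with \<phi> have "X \<longlonglongrightarrow> \<gamma>"
    by (simp add: tendsto_iff dist_lip_free_functional)
  then show "convergent X"
    by (auto simp: convergent_def)
qed

definition lip_pairing :: "'a::pointed_metric_space lip0 \<Rightarrow> 'a lip_free \<Rightarrow> real" where
  "lip_pairing f \<gamma> = blinfun_apply (lip_free_functional \<gamma>) f"

section \<open>Locally flat Lipschitz functions\<close>

text \<open>The supremum is taken in \<^typ>\<open>ennreal\<close>, so that it is \<open>0\<close> when no two distinct points
  are at distance less than \<open>\<epsilon>\<close>.\<close>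

definition little_lip0 :: "'a::pointed_metric_space lip0 set" where
  "little_lip0 = {f. ((\<lambda>\<epsilon>. SUP (x, y) \<in> {(x, y). 0 < dist x y \<and> dist x y < \<epsilon>}.
      ennreal (\<bar>lip0_apply f x - lip0_apply f y\<bar> / dist x y)) \<longlongrightarrow> 0) (at_right 0)}"

definition lip0_norming :: "'a::pointed_metric_space itself \<Rightarrow> real \<Rightarrow> bool" where
  "lip0_norming _ C \<longleftrightarrow> (\<forall>\<gamma> :: 'a lip_free.
     norm \<gamma> \<le> C * (SUP f \<in> {f \<in> little_lip0. norm f \<le> 1}. \<bar>lip_pairing f \<gamma>\<bar>))"

section \<open>The Schur property\<close>

definition weakly_null :: "(nat \<Rightarrow> 'b::real_normed_vector) \<Rightarrow> bool" where
  "weakly_null x \<longleftrightarrow> (\<forall>\<phi> :: 'b \<Rightarrow>\<^sub>L real. (\<lambda>n. blinfun_apply \<phi> (x n)) \<longlonglongrightarrow> 0)"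

definition schur_property :: "'b::banach itself \<Rightarrow> bool" where
  "schur_property _ \<longleftrightarrow> (\<forall>x :: nat \<Rightarrow> 'b. weakly_null x \<longrightarrow> x \<longlonglongrightarrow> 0)"

end

theory Submission
  imports Defs
begin

text \<open>
  After a small perturbation, a weakly null sequence that is not norm null consists of finitely
  supported elements \<open>\<gamma>\<^sub>n\<close> with norms bounded below. A gliding hump with disjointly supported
  functions (a disjoint sum of \<open>L\<close>-Lipschitz functions is \<open>2L\<close>-Lipschitz) shows that the
  \<open>\<gamma>\<^sub>n\<close> are tight: up to a small error they eventually only see the \<open>\<delta>\<close>-neighbourhood of some
  finite set \<open>E\<close>. On \<open>E\<close> the unit ball of \<open>lip\<^sub>0\<close> is totally bounded, so subtracting from a
  nearly norming \<open>f\<close> one of finitely many \<open>g\<close>, on which \<open>\<gamma>\<^sub>n\<close> is small, and truncating gives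
  uniformly small functions in \<open>lip\<^sub>0\<close>, with Lipschitz constant at most \<open>2\<close>, on which \<open>\<gamma>\<^sub>n\<close> stays
  large. A second gliding hump adds such functions: each is so small that it is negligible at all
  scales where the previous partial sum is not yet flat, so the sum is Lipschitz, and it
  contradicts weak nullity.
\<close>

section \<open>Lipschitz and locally flat functions\<close>

lemma lip0_apply_diff_le: "\<bar>lip0_apply f x - lip0_apply f y\<bar> \<le> norm f * dist x y"
  using lipschitz_onD[OF lip0_norm_lipschitz[of f], of x y] by (simp add: dist_real_def)

lemma lip0_abs_le: "\<bar>lip0_apply f x\<bar> \<le> norm f * dist x basepoint"
  using lip0_apply_diff_le[of f x basepoint] by simp

lemma lip0_norm_leI:
  assumes "0 \<le> L" and "\<And>x y. \<bar>lip0_apply f x - lip0_apply f y\<bar> \<le> L * dist x y"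
  shows "norm f \<le> L"
  by (rule lip0_norm_le) (auto intro!: lipschitz_onI simp: dist_real_def assms)

lemma lip0_exists:
  fixes g :: "'a::pointed_metric_space \<Rightarrow> real"
  assumes "0 \<le> L" and "g basepoint = 0" and "\<And>x y. \<bar>g x - g y\<bar> \<le> L * dist x y"
  obtains f where "norm f \<le> L" and "\<And>x. lip0_apply f x = g x"
proof -
  have "L-lipschitz_on UNIV g"
    using assms by (auto intro!: lipschitz_onI simp: dist_real_def)
  then have "lip0_apply (Abs_lip0 g) = g"
    using assms(2) by (subst Abs_lip0_inverse) auto
  moreover from this have "norm (Abs_lip0 g) \<le> L"
    using assms by (intro lip0_norm_leI) auto
  ultimately show thesis using that by metis
qed

text \<open>This is how infinite sums of humps are formed: their partial sums have bounded norms and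
  converge pointwise, but in general not in norm.\<close>

lemma lip0_pointwise_limit:
  fixes F :: "nat \<Rightarrow> 'a::pointed_metric_space lip0"
  assumes "\<And>k. norm (F k) \<le> L" and "\<And>x. convergent (\<lambda>k. lip0_apply (F k) x)"
  obtains H where "norm H \<le> L" and "\<And>x. (\<lambda>k. lip0_apply (F k) x) \<longlonglongrightarrow> lip0_apply H x"
proof -
  define g where "g = (\<lambda>x. lim (\<lambda>k. lip0_apply (F k) x))"
  have g: "(\<lambda>k. lip0_apply (F k) x) \<longlonglongrightarrow> g x" for x
    using assms(2) by (simp add: g_def convergent_LIMSEQ_iff)
  have "0 \<le> L" using assms(1)[of 0] norm_ge_zero order_trans by blast
  moreover have "g basepoint = 0" using g[of basepoint] by (simp add: LIMSEQ_const_iff)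
  moreover have "\<bar>g x - g y\<bar> \<le> L * dist x y" for x y
  proof (rule LIMSEQ_le_const2)
    show "(\<lambda>k. \<bar>lip0_apply (F k) x - lip0_apply (F k) y\<bar>) \<longlonglongrightarrow> \<bar>g x - g y\<bar>"
      by (intro tendsto_intros g)
    have "\<bar>lip0_apply (F k) x - lip0_apply (F k) y\<bar> \<le> L * dist x y" for k
      using lip0_apply_diff_le[of "F k" x y] mult_right_mono[OF assms(1)[of k], of "dist x y"]
      by simp
    then show "\<exists>N. \<forall>k\<ge>N. \<bar>lip0_apply (F k) x - lip0_apply (F k) y\<bar> \<le> L * dist x y"
      by blast
  qed
  ultimately obtain H where "norm H \<le> L" "\<And>x. lip0_apply H x = g x"
    by (rule lip0_exists) blast
  then show thesis using g that by metis
qed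

section \<open>Truncation of Lipschitz functions\<close>

lemma abs_clamp_diff_le:
  fixes a b u v d :: real
  assumes "\<bar>a - b\<bar> \<le> d" and "\<bar>u - v\<bar> \<le> d"
  shows "\<bar>max (- u) (min u a) - max (- v) (min v b)\<bar> \<le> d"
  using assms by (auto simp: max_def min_def abs_if split: if_splits)

text \<open>The height \<open>u\<close> varies with the point, so cutting can also localize: the
  result vanishes wherever \<open>u\<close> does, and the Lipschitz constant does not grow.\<close>

lemma lip0_clamp:
  fixes f :: "'a::pointed_metric_space lip0"
  assumes "norm f \<le> L" and "\<And>x. 0 \<le> u x" and "\<And>x y. \<bar>u x - u y\<bar> \<le> L * dist x y"
  obtains h where "norm h \<le> L"
    and "\<And>x. lip0_apply h x = max (- u x) (min (u x) (lip0_apply f x))"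
proof (rule lip0_exists)
  show "0 \<le> L" using assms(1) norm_ge_zero order_trans by blast
  show "max (- u basepoint) (min (u basepoint) (lip0_apply f basepoint)) = 0"
    using assms(2)[of basepoint] by simp
  fix x y
  have "\<bar>lip0_apply f x - lip0_apply f y\<bar> \<le> L * dist x y"
    using lip0_apply_diff_le[of f x y] mult_right_mono[OF assms(1), of "dist x y"] by simp
  then show "\<bar>max (- u x) (min (u x) (lip0_apply f x)) - max (- u y) (min (u y) (lip0_apply f y))\<bar>
      \<le> L * dist x y"
    using assms(3) by (rule abs_clamp_diff_le)
qed (rule that)

text \<open>Since \<bar>f x\<bar> is at most the distance of x to the base point, \<open>g\<close>
  agrees with \<open>f\<close> on the ball of radius \<open>r / 2\<close>, while it vanishes outside
  the ball of radius \<open>r\<close>.\<close>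

lemma lip0_truncate:
  fixes f :: "'a::pointed_metric_space lip0"
  assumes "norm f \<le> 1"
  obtains g where "norm g \<le> 1"
    and "\<And>x. lip0_apply g x = max (- max 0 (r - dist x basepoint))
      (min (max 0 (r - dist x basepoint)) (lip0_apply f x))"
proof (rule lip0_clamp[OF assms, of "\<lambda>x. max 0 (r - dist x basepoint)"])
  fix x y :: 'a
  have "\<bar>dist x basepoint - dist y basepoint\<bar> \<le> dist x y"
    using dist_triangle[of x basepoint y] dist_triangle3[of y basepoint x]
    by (simp add: dist_commute)
  then show "\<bar>max 0 (r - dist x basepoint) - max 0 (r - dist y basepoint)\<bar> \<le> 1 * dist x y"
    by (auto simp: max_def abs_if split: if_splits)
qed (auto intro: that)

lemma little_lip0_iff:
  fixes f :: "'a::pointed_metric_space lip0"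
  shows "f \<in> little_lip0 \<longleftrightarrow> (\<forall>e>0. \<exists>\<delta>>0. \<forall>x y. dist x y < \<delta> \<longrightarrow>
     \<bar>lip0_apply f x - lip0_apply f y\<bar> \<le> e * dist x y)"
  (is "_ \<longleftrightarrow> ?flat")
proof -
  define S where "S = (\<lambda>\<epsilon>. SUP (x, y) \<in> {(x :: 'a, y). 0 < dist x y \<and> dist x y < \<epsilon>}.
      ennreal (\<bar>lip0_apply f x - lip0_apply f y\<bar> / dist x y))"
  have S: "f \<in> little_lip0 \<longleftrightarrow> (S \<longlongrightarrow> 0) (at_right 0)"
    by (simp add: little_lip0_def S_def)
  have "?flat" if lim: "(S \<longlongrightarrow> 0) (at_right 0)"
  proof (intro allI impI)
    fix e :: real assume "0 < e"
    then have "\<forall>\<^sub>F \<epsilon> in at_right 0. S \<epsilon> < ennreal e"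
      by (intro order_tendstoD(2)[OF lim]) simp
    then obtain b where b: "0 < b" "\<And>\<epsilon>. 0 < \<epsilon> \<Longrightarrow> \<epsilon> < b \<Longrightarrow> S \<epsilon> < ennreal e"
      unfolding eventually_at_right_field by auto
    \<comment> \<open>The bound on \<open>S\<close> is available strictly below \<open>b\<close>
      only, so it is used at scale \<open>b / 2\<close>.\<close>
    have "\<bar>lip0_apply f x - lip0_apply f y\<bar> \<le> e * dist x y" if d: "dist x y < b / 2" for x y
    proof (cases "x = y")
      case False
      then have "ennreal (\<bar>lip0_apply f x - lip0_apply f y\<bar> / dist x y) \<le> S (b / 2)"
        unfolding S_def using d by (intro SUP_upper2[where i = "(x, y)"]) auto
      also have "\<dots> < ennreal e" using b by simp
      finally have "\<bar>lip0_apply f x - lip0_apply f y\<bar> / dist x y < e"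
        using \<open>0 < e\<close> by (simp add: ennreal_less_iff)
      then show ?thesis using False by (simp add: field_simps)
    qed simp
    then show "\<exists>\<delta>>0. \<forall>x y. dist x y < \<delta> \<longrightarrow>
        \<bar>lip0_apply f x - lip0_apply f y\<bar> \<le> e * dist x y"
      using b(1) by (intro exI[of _ "b / 2"]) auto
  qed
  moreover have "(S \<longlongrightarrow> 0) (at_right 0)" if flat: ?flat
  proof (rule order_tendstoI)
    fix a :: ennreal assume "0 < a"
    then obtain e where e: "0 < e" "ennreal e < a"
      by (metis ennreal_cases ennreal_less_zero_iff ennreal_less_top dense ennreal_0 not_gr_zero
          ennreal_neg linorder_not_less order.strict_trans zero_less_one top.not_eq_extremum)
    then obtain \<delta> where \<delta>: "\<delta> > 0"
      "\<And>x y. dist x y < \<delta> \<Longrightarrow> \<bar>lip0_apply f x - lip0_apply f y\<bar> \<le> e * dist x y"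
      using flat by meson
    have "S \<epsilon> \<le> ennreal e" if "\<epsilon> < \<delta>" for \<epsilon>
      unfolding S_def
    proof (rule SUP_least, clarify)
      fix x y :: 'a assume xy: "0 < dist x y" "dist x y < \<epsilon>"
      then show "ennreal (\<bar>lip0_apply f x - lip0_apply f y\<bar> / dist x y) \<le> ennreal e"
        using \<delta>(2)[of x y] that by (intro ennreal_leI) (simp add: divide_le_eq)
    qed
    then show "\<forall>\<^sub>F \<epsilon> in at_right 0. S \<epsilon> < a"
      unfolding eventually_at_right_field using \<delta>(1) e(2) by (intro exI[of _ \<delta>]) force
  qed simp
  ultimately show ?thesis using S by blast
qed

lemma little_lip0_zero: "0 \<in> little_lip0"
  unfolding little_lip0_iff by (auto intro: exI[of _ 1])

text \<open>One criterion that covers sums, differences and truncation at a constant height.\<close>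

lemma little_lip0_dominated:
  assumes "f \<in> little_lip0" and "g \<in> little_lip0"
    and "\<And>x y. \<bar>lip0_apply h x - lip0_apply h y\<bar>
      \<le> \<bar>lip0_apply f x - lip0_apply f y\<bar> + \<bar>lip0_apply g x - lip0_apply g y\<bar>"
  shows "h \<in> little_lip0"
  unfolding little_lip0_iff
proof (intro allI impI)
  fix e :: real assume "0 < e"
  then have "0 < e / 2" by simp
  with assms(1,2) obtain a b where "0 < a" "0 < b"
    and ab: "\<And>x y. dist x y < a \<Longrightarrow> \<bar>lip0_apply f x - lip0_apply f y\<bar> \<le> e / 2 * dist x y"
      "\<And>x y. dist x y < b \<Longrightarrow> \<bar>lip0_apply g x - lip0_apply g y\<bar> \<le> e / 2 * dist x y"
    unfolding little_lip0_iff by metis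
  have "\<bar>lip0_apply h x - lip0_apply h y\<bar> \<le> e * dist x y" if "dist x y < min a b" for x y
    using ab[of x y] assms(3)[of x y] that by (simp add: field_simps)
  then show "\<exists>\<delta>>0. \<forall>x y. dist x y < \<delta> \<longrightarrow>
      \<bar>lip0_apply h x - lip0_apply h y\<bar> \<le> e * dist x y"
    using \<open>0 < a\<close> \<open>0 < b\<close> by (intro exI[of _ "min a b"]) auto
qed

lemma little_lip0_add: "f \<in> little_lip0 \<Longrightarrow> g \<in> little_lip0 \<Longrightarrow> f + g \<in> little_lip0"
  by (rule little_lip0_dominated[of f g]) auto

lemma little_lip0_diff: "f \<in> little_lip0 \<Longrightarrow> g \<in> little_lip0 \<Longrightarrow> f - g \<in> little_lip0"
  by (rule little_lip0_dominated[of f g]) auto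

text \<open>A constant height adds no variation of its own, so local flatness is inherited from
  \<open>f\<close> alone.\<close>

lemma little_lip0_clamp:
  assumes "f \<in> little_lip0" and "\<And>x. lip0_apply h x = max (- r) (min r (lip0_apply f x))"
  shows "h \<in> little_lip0"
  by (rule little_lip0_dominated[OF assms(1) little_lip0_zero])
    (simp add: assms(2) abs_clamp_diff_le)

section \<open>The pairing and finitely supported elements\<close>

lemma lip_pairing_zero [simp]: "lip_pairing 0 \<gamma> = 0"
  and lip_pairing_diff: "lip_pairing (f - g) \<gamma> = lip_pairing f \<gamma> - lip_pairing g \<gamma>"
  and lip_pairing_scaleR: "lip_pairing (c *\<^sub>R f) \<gamma> = c * lip_pairing f \<gamma>"
  by (simp_all add: lip_pairing_def blinfun.bilinear_simps)

lemma lip_pairing_le: "\<bar>lip_pairing f \<gamma>\<bar> \<le> norm f * norm \<gamma>"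
  using norm_blinfun[of "lip_free_functional \<gamma>" f]
  by (simp add: lip_pairing_def norm_lip_free_def mult.commute)

lemma bounded_linear_lip_pairing: "bounded_linear (lip_pairing f)"
  using lip_pairing_le[of f]
  by (intro bounded_linear_intro[of _ "norm f"])
    (auto simp: lip_pairing_def blinfun.bilinear_simps mult.commute)

lemma weakly_null_lip_pairing:
  assumes "weakly_null \<gamma>"
  shows "(\<lambda>n. lip_pairing f (\<gamma> n)) \<longlonglongrightarrow> 0"
  using assms bounded_linear_Blinfun_apply[OF bounded_linear_lip_pairing[of f]]
  unfolding weakly_null_def by metis

text \<open>An estimate satisfied by finite combinations of point evaluations, with \<open>A\<close>
  the support and \<open>K\<close> the sum of the absolute coefficients. The case
  \<open>r = 0\<close> says that only the values on \<open>A\<close> matter; positive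
  \<open>r\<close> makes uniformly small functions negligible.\<close>

definition finitely_supported :: "'a::pointed_metric_space lip_free \<Rightarrow> bool" where
  "finitely_supported \<gamma> \<longleftrightarrow> (\<exists>A K. finite A \<and> 0 \<le> K \<and>
     (\<forall>f r. (\<forall>x\<in>A. \<bar>lip0_apply f x\<bar> \<le> r) \<longrightarrow> \<bar>lip_pairing f \<gamma>\<bar> \<le> K * r))"

lemma span_lip_delta_bound:
  assumes "\<phi> \<in> span (range lip_delta)"
  shows "\<exists>A K. finite A \<and> 0 \<le> K \<and>
    (\<forall>f r. (\<forall>x\<in>A. \<bar>lip0_apply f x\<bar> \<le> r) \<longrightarrow> \<bar>blinfun_apply \<phi> f\<bar> \<le> K * r)"
  using assms
proof (induction rule: span_induct_alt)
  case base
  show ?case by (intro exI[of _ "{}"] exI[of _ 0]) simp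
next
  case (step c \<psi> \<phi>)
  then obtain z where z: "\<psi> = lip_delta z" by blast
  from step obtain A K where AK: "finite A" "0 \<le> K"
    "\<And>f r. (\<forall>x\<in>A. \<bar>lip0_apply f x\<bar> \<le> r) \<Longrightarrow> \<bar>blinfun_apply \<phi> f\<bar> \<le> K * r"
    by blast
  have "\<bar>blinfun_apply (c *\<^sub>R \<psi> + \<phi>) f\<bar> \<le> (\<bar>c\<bar> + K) * r"
    if "\<forall>x\<in>insert z A. \<bar>lip0_apply f x\<bar> \<le> r" for f r
  proof -
    have "\<bar>c * lip0_apply f z\<bar> \<le> \<bar>c\<bar> * r"
      using that by (simp add: abs_mult mult_left_mono)
    moreover have "\<bar>blinfun_apply \<phi> f\<bar> \<le> K * r" using that AK(3) by auto
    ultimately show ?thesis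
      by (simp add: z blinfun.bilinear_simps distrib_right)
  qed
  then show ?case using AK(1,2)
    by (intro exI[of _ "insert z A"] exI[of _ "\<bar>c\<bar> + K"]) auto
qed

lemma finitely_supported_dense:
  assumes "0 < e"
  obtains \<mu> where "finitely_supported \<mu>" and "norm (\<gamma> - \<mu>) < e"
proof -
  have "lip_free_functional \<gamma> \<in> closure (span (range lip_delta))"
    by (rule lip_free_functional)
  then obtain \<phi> where \<phi>: "\<phi> \<in> span (range lip_delta)" "dist \<phi> (lip_free_functional \<gamma>) < e"
    using assms unfolding closure_approachable by blast
  then obtain \<mu> where \<mu>: "\<phi> = lip_free_functional \<mu>"
    using closure_subset Abs_lip_free_inverse by (metis subsetD)
  have "finitely_supported \<mu>"
    using span_lip_delta_bound[OF \<phi>(1)] by (simp add: finitely_supported_def lip_pairing_def \<mu>)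
  moreover have "norm (\<gamma> - \<mu>) < e"
    using \<phi>(2) by (simp add: \<mu> dist_lip_free_functional dist_norm[symmetric] dist_commute)
  ultimately show thesis by (rule that)
qed

lemma finitely_supportedE:
  assumes "finitely_supported \<gamma>"
  obtains A where "finite A"
    and "\<And>f g. (\<And>x. x \<in> A \<Longrightarrow> lip0_apply f x = lip0_apply g x) \<Longrightarrow> lip_pairing f \<gamma> = lip_pairing g \<gamma>"
proof -
  obtain A K where A: "finite A"
    "\<And>f r. (\<forall>x\<in>A. \<bar>lip0_apply f x\<bar> \<le> r) \<Longrightarrow> \<bar>lip_pairing f \<gamma>\<bar> \<le> K * r"
    using assms unfolding finitely_supported_def by blast
  have "lip_pairing f \<gamma> = lip_pairing g \<gamma>"
    if "\<And>x. x \<in> A \<Longrightarrow> lip0_apply f x = lip0_apply g x" for f g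
    using A(2)[of "f - g" 0] that by (simp add: lip_pairing_diff)
  then show thesis using A(1) that by blast
qed

section \<open>Gliding humps\<close>

text \<open>Weak nullity enters only through pairings with Lipschitz functions; finite support is
  what the initial perturbation provides.\<close>

locale null_sequence =
  fixes \<gamma> :: "nat \<Rightarrow> 'a::pointed_metric_space lip_free"
  assumes null: "(\<lambda>n. lip_pairing f (\<gamma> n)) \<longlonglongrightarrow> 0"
    and fin: "finitely_supported (\<gamma> n)"
begin

lemma eventually_small: "0 < e \<Longrightarrow> \<exists>N. \<forall>n\<ge>N. \<bar>lip_pairing f (\<gamma> n)\<bar> < e"
  using LIMSEQ_D[OF null] by force

text \<open>Split \<open>H\<close> into \<open>F k\<close>, the hump \<open>F (Suc k) - F k\<close>
  and the tail \<open>H - F (Suc k)\<close>. The outer pieces contribute at most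
  \<open>e / 4\<close> each, so the pairing with \<open>H\<close> is at least \<open>e / 2\<close>
  at infinitely many indices and cannot tend to zero.\<close>

lemma no_humps:
  assumes "0 < e" and "\<And>k. nn k < nn (Suc k)"
    and "\<And>k. \<bar>lip_pairing (F k) (\<gamma> (nn (Suc k)))\<bar> \<le> e / 4"
    and "\<And>k. e \<le> \<bar>lip_pairing (F (Suc k) - F k) (\<gamma> (nn (Suc k)))\<bar>"
    and "\<And>k. \<bar>lip_pairing (H - F (Suc k)) (\<gamma> (nn (Suc k)))\<bar> \<le> e / 4"
  shows False
proof -
  have "strict_mono nn" using assms(2) by (simp add: strict_mono_Suc_iff)
  moreover obtain N where N: "\<forall>n\<ge>N. \<bar>lip_pairing H (\<gamma> n)\<bar> < e / 4"
    using eventually_small[of "e / 4" H] assms(1) by auto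
  ultimately have "\<bar>lip_pairing H (\<gamma> (nn (Suc N)))\<bar> < e / 4"
    using seq_suble[of nn "Suc N"] by simp
  then show False
    using assms(1) assms(3-5)[of N] unfolding lip_pairing_diff by linarith
qed

text \<open>The humps live in successive shells \<open>W\<close> minus \<open>V\<close>, so their
  sum stays Lipschitz. Each chosen element of the sequence is carried by its own \<open>W\<close>,
  on which all later humps vanish: the tail contributes exactly zero.\<close>

lemma no_disjoint_humps:
  assumes "0 < e" and "V0 \<in> \<V>" and "0 \<le> L"
    and step: "\<And>V N. V \<in> \<V> \<Longrightarrow> \<exists>n\<ge>N. \<exists>h. \<exists>W\<in>\<V>. V \<subseteq> W \<and> norm h \<le> L \<and>
      (\<forall>x\<in>V. lip0_apply h x = 0) \<and> (\<forall>x. x \<notin> W \<longrightarrow> lip0_apply h x = 0) \<and>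
      e \<le> \<bar>lip_pairing h (\<gamma> n)\<bar> \<and>
      (\<forall>f. (\<forall>x\<in>W. lip0_apply f x = 0) \<longrightarrow> lip_pairing f (\<gamma> n) = 0)"
  shows False
proof -
  txt \<open>The last conjunct of \<open>P\<close> keeps the constant of the partial sums from growing: it bounds
    \<open>F\<close> near the boundary of \<open>V\<close>, where the next hump starts.\<close>
  define P where "P = (\<lambda>(V, F, n::nat). V \<in> \<V> \<and> norm F \<le> 2 * L \<and>
    (\<forall>x. x \<notin> V \<longrightarrow> lip0_apply F x = 0) \<and> (\<forall>x y. y \<notin> V \<longrightarrow> \<bar>lip0_apply F x\<bar> \<le> L * dist x y))"
  define Q where "Q = (\<lambda>(V, F, n::nat) (W, G, m). V \<subseteq> W \<and> n < m \<and>
    (\<forall>x\<in>V. lip0_apply G x = lip0_apply F x) \<and>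
    \<bar>lip_pairing F (\<gamma> m)\<bar> \<le> e / 4 \<and> e \<le> \<bar>lip_pairing (G - F) (\<gamma> m)\<bar> \<and>
    (\<forall>f. (\<forall>x\<in>W. lip0_apply f x = 0) \<longrightarrow> lip_pairing f (\<gamma> m) = 0))"
  have P0: "\<exists>s. P s"
    using assms(2,3) by (intro exI[of _ "(V0, 0, 0)"]) (simp add: P_def)
  have PQ: "\<exists>t. P t \<and> Q s t" if "P s" for s
  proof -
    obtain V F n where s: "s = (V, F, n)" by (cases s)
    have V: "V \<in> \<V>" and F: "norm F \<le> 2 * L" "\<And>x. x \<notin> V \<Longrightarrow> lip0_apply F x = 0"
      "\<And>x y. y \<notin> V \<Longrightarrow> \<bar>lip0_apply F x\<bar> \<le> L * dist x y"
      using that by (auto simp: P_def s)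
    obtain N where N: "\<forall>n\<ge>N. \<bar>lip_pairing F (\<gamma> n)\<bar> < e / 4"
      using eventually_small[of "e / 4" F] assms(1) by auto
    from step[OF V, of "max N (Suc n)"] obtain m h W where m: "m \<ge> max N (Suc n)"
      and W: "W \<in> \<V>" "V \<subseteq> W" and h: "norm h \<le> L" "\<And>x. x \<in> V \<Longrightarrow> lip0_apply h x = 0"
        "\<And>x. x \<notin> W \<Longrightarrow> lip0_apply h x = 0" "e \<le> \<bar>lip_pairing h (\<gamma> m)\<bar>"
      and W': "\<forall>f. (\<forall>x\<in>W. lip0_apply f x = 0) \<longrightarrow> lip_pairing f (\<gamma> m) = 0"
      by blast
    have hL: "\<bar>lip0_apply h x - lip0_apply h y\<bar> \<le> L * dist x y" for x y
      using lip0_apply_diff_le[of h x y] mult_right_mono[OF h(1), of "dist x y"] by simp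
    have FL: "\<bar>lip0_apply F x - lip0_apply F y\<bar> \<le> 2 * L * dist x y" for x y
      using lip0_apply_diff_le[of F x y] mult_right_mono[OF F(1), of "dist x y"] by simp
    \<comment> \<open>Both terms are at most \<open>L * dist x y\<close>: the first by the boundary
      invariant, the second because \<open>h\<close> vanishes at \<open>x\<close>.\<close>
    have mixed: "\<bar>lip0_apply F x - lip0_apply h y\<bar> \<le> 2 * L * dist x y" if "x \<in> V" "y \<notin> V" for x y
      using F(3)[of y x] that hL[of x y] h(2)[of x] by simp
    have Ld: "0 \<le> L * dist x y" for x y using assms(3) by simp
    have "norm (F + h) \<le> 2 * L"
    proof (rule lip0_norm_leI)
      fix x y
      consider "x \<in> V" "y \<in> V" | "x \<notin> V" "y \<notin> V" | "x \<in> V" "y \<notin> V" | "x \<notin> V" "y \<in> V"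
        by blast
      then show "\<bar>lip0_apply (F + h) x - lip0_apply (F + h) y\<bar> \<le> 2 * L * dist x y"
      proof cases
        case 1 then show ?thesis using FL[of x y] h(2) by simp
      next
        case 2 then show ?thesis using hL[of x y] F(2) Ld[of x y] by simp
      next
        case 3 then show ?thesis using mixed[of x y] F(2) h(2) by simp
      next
        case 4 then show ?thesis using mixed[of y x] F(2) h(2)
          by (simp add: dist_commute abs_minus_commute)
      qed
    qed (use assms(3) in simp)
    \<comment> \<open>The boundary invariant passes to \<open>W\<close>: on \<open>V\<close> it is
      the old one, and off \<open>V\<close> only \<open>h\<close> remains, which vanishes at
      \<open>y\<close>.\<close>
    moreover have "\<bar>lip0_apply (F + h) x\<bar> \<le> L * dist x y" if "y \<notin> W" for x y
    proof (cases "x \<in> V")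
      case True
      have "y \<notin> V" using that W(2) by blast
      then show ?thesis using F(3) h(2) True by simp
    next
      case False
      then show ?thesis using hL[of x y] h(3)[OF that] F(2) by simp
    qed
    moreover have "\<forall>x. x \<notin> W \<longrightarrow> lip0_apply F x = 0" using F(2) W(2) by blast
    ultimately have "P (W, F + h, m)"
      using W h(3) by (auto simp: P_def)
    moreover have "Q s (W, F + h, m)"
      using W W' h m N by (auto simp: Q_def s less_imp_le)
    ultimately show ?thesis by blast
  qed
  obtain s where s: "\<And>k. P (s k)" "\<And>k. Q (s k) (s (Suc k))"
    using dependent_nat_choice[of "\<lambda>_. P" "\<lambda>_. Q"] P0 PQ by blast
  define V F nn where "V = (\<lambda>k. fst (s k))" and "F = (\<lambda>k. fst (snd (s k)))"
    and "nn = (\<lambda>k. snd (snd (s k)))"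
  have sk: "s k = (V k, F k, nn k)" for k by (simp add: V_def F_def nn_def)
  have P: "norm (F k) \<le> 2 * L" "x \<notin> V k \<Longrightarrow> lip0_apply (F k) x = 0" for k x
    using s(1)[of k] by (auto simp: sk P_def)
  have Q: "V k \<subseteq> V (Suc k)" "nn k < nn (Suc k)"
    "x \<in> V k \<Longrightarrow> lip0_apply (F (Suc k)) x = lip0_apply (F k) x"
    "\<bar>lip_pairing (F k) (\<gamma> (nn (Suc k)))\<bar> \<le> e / 4"
    "e \<le> \<bar>lip_pairing (F (Suc k) - F k) (\<gamma> (nn (Suc k)))\<bar>"
    "(\<And>x. x \<in> V (Suc k) \<Longrightarrow> lip0_apply f x = 0) \<Longrightarrow> lip_pairing f (\<gamma> (nn (Suc k))) = 0" for k x f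
    using s(2)[of k] by (auto simp: sk Q_def)
  have stable: "lip0_apply (F j) x = lip0_apply (F k) x" if "k \<le> j" "x \<in> V k" for j k x
    using that(1)
  proof (induction rule: dec_induct)
    case (step j)
    have "x \<in> V j" using lift_Suc_mono_le[of V, OF Q(1) step(1)] that(2) by blast
    then show ?case using Q(3) step by simp
  qed simp
  have lim: "(\<lambda>k. lip0_apply (F k) x) \<longlonglongrightarrow> lip0_apply (F k) x" if "x \<in> V k" for x k
    using stable[OF _ that] by (intro tendsto_eventually eventually_sequentiallyI[of k])
  have "convergent (\<lambda>k. lip0_apply (F k) x)" for x
  proof (cases "\<exists>k. x \<in> V k")
    case True
    then show ?thesis using lim unfolding convergent_def by blast
  next
    case False
    then show ?thesis using P(2) by (simp add: convergent_const)
  qed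
  with P(1) obtain H where H: "\<And>x. (\<lambda>k. lip0_apply (F k) x) \<longlonglongrightarrow> lip0_apply H x"
    by (rule lip0_pointwise_limit) blast
  have "lip0_apply H x = lip0_apply (F k) x" if "x \<in> V k" for x k
    using LIMSEQ_unique[OF H lim[OF that]] .
  then have "lip_pairing (H - F (Suc k)) (\<gamma> (nn (Suc k))) = 0" for k
    by (intro Q(6)) simp
  then show False
    using no_humps[of e nn F H] Q(2,4,5) assms(1) by simp
qed

section \<open>Tightness\<close>

text \<open>Otherwise every ball admits a function vanishing on it that pairs largely with a late
  element. That element has finite support, so the function can be truncated to a bounded hump, and
  the humps are disjoint.\<close>

lemma tight_ball:
  assumes "0 < e"
  shows "\<exists>R\<ge>0. \<exists>N. \<forall>n\<ge>N. \<forall>f. norm f \<le> 1 \<longrightarrow> (\<forall>x\<in>cball basepoint R. lip0_apply f x = 0) \<longrightarrow>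
    \<bar>lip_pairing f (\<gamma> n)\<bar> \<le> e"
proof (rule ccontr)
  assume neg: "\<not> ?thesis"
  show False
  proof (rule no_disjoint_humps[of e "cball basepoint 0" "cball basepoint ` {0..}" 1])
    fix V :: "'a set" and N :: nat
    assume "V \<in> cball basepoint ` {0..}"
    then obtain R where R: "0 \<le> R" "V = cball basepoint R" by auto
    with neg obtain n f where n: "n \<ge> N" and f: "norm f \<le> 1"
      "\<And>x. x \<in> V \<Longrightarrow> lip0_apply f x = 0" "e < \<bar>lip_pairing f (\<gamma> n)\<bar>"
      by (metis not_le)
    obtain A where A: "finite A" "\<And>f g. (\<And>x. x \<in> A \<Longrightarrow> lip0_apply f x = lip0_apply g x) \<Longrightarrow>
        lip_pairing f (\<gamma> n) = lip_pairing g (\<gamma> n)"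
      using finitely_supportedE[OF fin[of n]] by blast
    obtain S0 where S0: "\<And>x. x \<in> A \<Longrightarrow> dist basepoint x \<le> S0"
      using finite_imp_bounded[OF A(1)] unfolding bounded_any_center[of _ basepoint] by blast
    define S where "S = max R S0"
    have S: "R \<le> S" "0 \<le> S" "x \<in> A \<Longrightarrow> dist x basepoint \<le> S" for x
      using S0[of x] R(1) by (auto simp: S_def dist_commute)
    obtain h where h: "norm h \<le> 1"
      "\<And>x. lip0_apply h x = max (- max 0 (2 * S - dist x basepoint))
        (min (max 0 (2 * S - dist x basepoint)) (lip0_apply f x))"
      using lip0_truncate[OF f(1), of "2 * S"] by blast
    \<comment> \<open>On \<open>A\<close> the value of \<open>f\<close> is at most \<open>S\<close>,
      and the height \<open>2 * S - dist x basepoint\<close> is at least \<open>S\<close>.\<close>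
    have "lip0_apply h x = lip0_apply f x" if "x \<in> A" for x
      using S(3)[OF that] lip0_abs_le[of f x] mult_right_mono[OF f(1), of "dist x basepoint"]
      by (simp add: h(2))
    then have hf: "lip_pairing h (\<gamma> n) = lip_pairing f (\<gamma> n)" by (rule A(2))
    have "A \<subseteq> cball basepoint (2 * S)" using S(2,3) by (force simp: dist_commute)
    then have "\<forall>f. (\<forall>x\<in>cball basepoint (2 * S). lip0_apply f x = 0) \<longrightarrow> lip_pairing f (\<gamma> n) = 0"
      using A(2)[of _ 0] by force
    moreover have "\<forall>x\<in>V. lip0_apply h x = 0" using f(2) by (simp add: h(2))
    moreover have "\<forall>x. x \<notin> cball basepoint (2 * S) \<longrightarrow> lip0_apply h x = 0"
      by (simp add: h(2) dist_commute)
    moreover have "V \<subseteq> cball basepoint (2 * S)" using S(1,2) R by auto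
    ultimately show "\<exists>n\<ge>N. \<exists>h. \<exists>W\<in>cball basepoint ` {0..}. V \<subseteq> W \<and> norm h \<le> 1 \<and>
        (\<forall>x\<in>V. lip0_apply h x = 0) \<and> (\<forall>x. x \<notin> W \<longrightarrow> lip0_apply h x = 0) \<and>
        e \<le> \<bar>lip_pairing h (\<gamma> n)\<bar> \<and>
        (\<forall>f. (\<forall>x\<in>W. lip0_apply f x = 0) \<longrightarrow> lip_pairing f (\<gamma> n) = 0)"
      using n h(1) hf f(3) S(2)
      by (intro exI[of _ n] conjI exI[of _ h] bexI[of _ "cball basepoint (2 * S)"]) auto
  qed (use assms in auto)
qed

text \<open>Tightness on a ball allows replacing test functions by ones bounded by
  \<open>2 * R\<close>. These can be cut off within distance \<delta> of the finite support with a
  constant \<open>K\<close> independent of the index, so the disjoint hump argument applies.\<close>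

lemma tight_finite_nbhd:
  assumes "0 < e" and "0 < \<delta>"
  shows "\<exists>E N. finite E \<and> (\<forall>n\<ge>N. \<forall>f. norm f \<le> 1 \<longrightarrow>
    (\<forall>x\<in>(\<Union>a\<in>E. cball a \<delta>). lip0_apply f x = 0) \<longrightarrow> \<bar>lip_pairing f (\<gamma> n)\<bar> \<le> e)"
proof (rule ccontr)
  assume neg: "\<not> ?thesis"
  obtain R M where R: "0 \<le> R" "\<And>n f. n \<ge> M \<Longrightarrow> norm f \<le> 1 \<Longrightarrow>
      (\<And>x. x \<in> cball basepoint R \<Longrightarrow> lip0_apply f x = 0) \<Longrightarrow> \<bar>lip_pairing f (\<gamma> n)\<bar> \<le> e / 4"
  proof -
    have "0 < e / 4" using assms(1) by simp
    from tight_ball[OF this] obtain R M where "0 \<le> R" and "\<forall>n\<ge>M. \<forall>f. norm f \<le> 1 \<longrightarrow>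
        (\<forall>x\<in>cball basepoint R. lip0_apply f x = 0) \<longrightarrow> \<bar>lip_pairing f (\<gamma> n)\<bar> \<le> e / 4"
      by blast
    then show thesis by (intro that[of R M]) blast+
  qed
  \<comment> \<open>The slope at which a tent of radius \<delta> reaches height at least
    \<open>2 * R\<close>.\<close>
  define K where "K = max 1 (2 * R / \<delta>)"
  have K: "1 \<le> K" "2 * R \<le> K * \<delta>"
    using assms(2) by (auto simp: K_def max_def field_simps)
  define \<V> where "\<V> = {V :: 'a set. \<exists>E. finite E \<and> V = (\<Union>a\<in>E. cball a \<delta>)}"
  show False
  proof (rule no_disjoint_humps[of "e / 2" "{}" \<V> K])
    show "{} \<in> \<V>" unfolding \<V>_def by blast
    fix V :: "'a set" and N :: nat
    assume "V \<in> \<V>"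
    then obtain E where E: "finite E" "V = (\<Union>a\<in>E. cball a \<delta>)" unfolding \<V>_def by blast
    with neg obtain n f where n: "n \<ge> max N M" and f: "norm f \<le> 1"
      "\<And>x. x \<in> V \<Longrightarrow> lip0_apply f x = 0" "e < \<bar>lip_pairing f (\<gamma> n)\<bar>"
      by (metis not_le)
    obtain g where g: "norm g \<le> 1"
      "\<And>x. lip0_apply g x = max (- max 0 (2 * R - dist x basepoint))
        (min (max 0 (2 * R - dist x basepoint)) (lip0_apply f x))"
      using lip0_truncate[OF f(1), of "2 * R"] by blast
    \<comment> \<open>The factor brings \<open>f - g\<close> into the unit ball. On the ball of
      radius \<open>R\<close> the truncation leaves \<open>f\<close> unchanged, so the difference
      vanishes there.\<close>
    have "\<bar>lip_pairing ((1/2) *\<^sub>R (f - g)) (\<gamma> n)\<bar> \<le> e / 4"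
    proof (rule R(2))
      show "norm ((1/2) *\<^sub>R (f - g)) \<le> 1"
        using norm_triangle_ineq4[of f g] f(1) g(1) by simp
      fix x :: 'a assume "x \<in> cball basepoint R"
      then show "lip0_apply ((1/2) *\<^sub>R (f - g)) x = 0"
        using lip0_abs_le[of f x] mult_right_mono[OF f(1), of "dist x basepoint"]
        by (simp add: g(2) dist_commute)
    qed (use n in simp)
    then have "\<bar>lip_pairing f (\<gamma> n) - lip_pairing g (\<gamma> n)\<bar> \<le> e / 2"
      unfolding lip_pairing_scaleR lip_pairing_diff abs_mult by simp
    then have ge: "e / 2 \<le> \<bar>lip_pairing g (\<gamma> n)\<bar>"
      using f(3) by linarith
    obtain A where A: "finite A" "\<And>f g. (\<And>x. x \<in> A \<Longrightarrow> lip0_apply f x = lip0_apply g x) \<Longrightarrow>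
        lip_pairing f (\<gamma> n) = lip_pairing g (\<gamma> n)"
      using finitely_supportedE[OF fin[of n]] by blast
    \<comment> \<open>\<open>E\<close> ensures that \<open>V\<close> lies in the new region;
      \<open>basepoint\<close> keeps \<open>B\<close> nonempty, as \<open>infdist\<close> to the
      empty set is zero by convention.\<close>
    define B where "B = insert basepoint (A \<union> E)"
    define u where "u = (\<lambda>x. max 0 (K * (\<delta> - infdist x B)))"
    have "\<bar>u x - u y\<bar> \<le> K * dist x y" for x y
    proof -
      have "\<bar>u x - u y\<bar> \<le> \<bar>K * (\<delta> - infdist x B) - K * (\<delta> - infdist y B)\<bar>"
        unfolding u_def by (auto simp: max_def abs_if)
      also have "\<dots> = K * \<bar>infdist x B - infdist y B\<bar>"
        using K(1) by (simp flip: right_diff_distrib add: abs_mult abs_minus_commute)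
      also have "\<bar>infdist x B - infdist y B\<bar> \<le> dist x y"
        by (rule infdist_triangle_abs)
      finally show ?thesis using K(1) by (simp add: mult_left_mono)
    qed
    moreover have "norm g \<le> K" "0 \<le> u x" for x
      using g(1) K(1) by (auto simp: u_def)
    ultimately obtain h where h: "norm h \<le> K"
      "\<And>x. lip0_apply h x = max (- u x) (min (u x) (lip0_apply g x))"
      using lip0_clamp[of g K u] by metis
    \<comment> \<open>On \<open>A\<close> the tent has its full height \<open>K * \<delta>\<close>,
      which dominates \<bar>g\<bar>.\<close>
    have "lip0_apply h x = lip0_apply g x" if "x \<in> A" for x
    proof -
      have "u x = max 0 (K * \<delta>)" using that by (simp add: u_def B_def)
      moreover have "\<bar>lip0_apply g x\<bar> \<le> 2 * R" 
      proof (rule order_trans)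
        show "\<bar>lip0_apply g x\<bar> \<le> max 0 (2 * R - dist x basepoint)" by (simp add: g(2) abs_le_iff)
      qed (use R(1) in simp)
      ultimately show ?thesis using K(2) by (simp add: h(2))
    qed
    then have hg: "lip_pairing h (\<gamma> n) = lip_pairing g (\<gamma> n)" by (rule A(2))
    define W where "W = (\<Union>a\<in>B. cball a \<delta>)"
    have B: "finite B" "B \<noteq> {}" using A(1) E(1) by (auto simp: B_def)
    have "lip0_apply h x = 0" if "x \<notin> W" for x
    proof -
      have "\<delta> \<le> infdist x B"
        unfolding infdist_notempty[OF B(2)]
        using that by (intro cINF_greatest[OF B(2)]) (force simp: W_def dist_commute)
      then have "K * (\<delta> - infdist x B) \<le> 0"
        using K(1) by (intro mult_nonneg_nonpos) auto
      then have "u x = 0" by (simp add: u_def)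
      then show ?thesis by (simp add: h(2))
    qed
    moreover have "lip0_apply h x = 0" if "x \<in> V" for x
      using f(2)[OF that] by (simp add: h(2) g(2) u_def)
    moreover have "A \<subseteq> W" using assms(2) by (force simp: W_def B_def)
    then have "\<forall>f. (\<forall>x\<in>W. lip0_apply f x = 0) \<longrightarrow> lip_pairing f (\<gamma> n) = 0"
      using A(2)[of _ 0] by force
    moreover have "V \<subseteq> W" by (auto simp: E(2) W_def B_def)
    moreover have "W \<in> \<V>" using B(1) by (auto simp: \<V>_def W_def)
    ultimately show "\<exists>n\<ge>N. \<exists>h. \<exists>W\<in>\<V>. V \<subseteq> W \<and> norm h \<le> K \<and>
        (\<forall>x\<in>V. lip0_apply h x = 0) \<and> (\<forall>x. x \<notin> W \<longrightarrow> lip0_apply h x = 0) \<and>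
        e / 2 \<le> \<bar>lip_pairing h (\<gamma> n)\<bar> \<and>
        (\<forall>f. (\<forall>x\<in>W. lip0_apply f x = 0) \<longrightarrow> lip_pairing f (\<gamma> n) = 0)"
      using n h(1) hg ge
      by (intro exI[of _ n] conjI exI[of _ h] bexI[of _ W]) auto
  qed (use assms K in auto)
qed

section \<open>Sums of uniformly small flat humps\<close>

text \<open>A new hump and the old partial sum never both vary much at one scale: below the flatness
  scale of the sum only the hump counts, above it the hump is too small to matter. Hence the norms
  stay below 4 without disjoint supports.\<close>

lemma no_flat_humps:
  assumes "0 < c"
    and step: "\<And>\<eta> N. 0 < \<eta> \<Longrightarrow> \<exists>n\<ge>N. \<exists>f\<in>little_lip0. norm f \<le> 2 \<and>
      (\<forall>x. \<bar>lip0_apply f x\<bar> \<le> \<eta>) \<and> c \<le> \<bar>lip_pairing f (\<gamma> n)\<bar>"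
  shows False
proof -
  define P where "P = (\<lambda>k (F :: 'a lip0, n::nat, \<eta>::real). F \<in> little_lip0 \<and> norm F \<le> 4 - 2 * (1/2)^k \<and> 0 < \<eta>)"
  \<comment> \<open>The third component of a state is the uniform size allowed for the next hump.
    The last conjunct fixes the next allowance \<theta> so that all later humps together, at most
    \<open>2 * \<theta>\<close>, are negligible at index \<open>m\<close>.\<close>
  define Q where "Q = (\<lambda>(F :: 'a lip0, n::nat, \<eta>::real) (G, m, \<theta>). n < m \<and> \<theta> \<le> \<eta> / 2 \<and>
    (\<forall>x. \<bar>lip0_apply G x - lip0_apply F x\<bar> \<le> \<eta>) \<and>
    \<bar>lip_pairing F (\<gamma> m)\<bar> \<le> c / 4 \<and> c \<le> \<bar>lip_pairing (G - F) (\<gamma> m)\<bar> \<and>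
    (\<forall>f. (\<forall>x. \<bar>lip0_apply f x\<bar> \<le> 2 * \<theta>) \<longrightarrow> \<bar>lip_pairing f (\<gamma> m)\<bar> \<le> c / 4))"
  have P0: "\<exists>s. P 0 s"
    by (intro exI[of _ "(0, 0, 1)"]) (simp add: P_def little_lip0_zero)
  have PQ: "\<exists>t. P (Suc k) t \<and> Q s t" if "P k s" for k s
  proof -
    obtain F n \<eta> where s: "s = (F, n, \<eta>)" by (cases s)
    \<comment> \<open>The growth permitted at this step: the norm bound passes from
      \<open>4 - 2 * \<epsilon>\<close> to \<open>4 - \<epsilon>\<close>, which is the invariant for
      \<open>Suc k\<close>.\<close>
    define \<epsilon> :: real where "\<epsilon> = (1/2)^k"
    have \<epsilon>: "0 < \<epsilon>" "\<epsilon> \<le> 1" by (auto simp: \<epsilon>_def power_le_one)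
    have F: "F \<in> little_lip0" "norm F \<le> 4 - 2 * \<epsilon>" and \<eta>: "0 < \<eta>"
      using that by (auto simp: P_def s \<epsilon>_def)
    obtain \<delta> where \<delta>: "0 < \<delta>"
      "\<And>x y. dist x y < \<delta> \<Longrightarrow> \<bar>lip0_apply F x - lip0_apply F y\<bar> \<le> \<epsilon> * dist x y"
      using F(1) \<epsilon>(1) unfolding little_lip0_iff by blast
    obtain N where N: "\<forall>n\<ge>N. \<bar>lip_pairing F (\<gamma> n)\<bar> < c / 4"
      using eventually_small[of "c / 4" F] assms(1) by auto
    \<comment> \<open>The second bound makes the variation of the hump at most
      \<open>\<epsilon> * \<delta>\<close>, hence at most \<open>\<epsilon> * dist x y\<close> at
      distances from \<delta> on.\<close>
    define \<eta>' where "\<eta>' = min \<eta> (\<epsilon> * \<delta> / 2)"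
    have "0 < \<eta>'" using \<eta> \<epsilon> \<delta> by (simp add: \<eta>'_def)
    from step[OF this, of "max N (Suc n)"] obtain m f where m: "m \<ge> max N (Suc n)"
      and f: "f \<in> little_lip0" "norm f \<le> 2" "\<And>x. \<bar>lip0_apply f x\<bar> \<le> \<eta>'"
        "c \<le> \<bar>lip_pairing f (\<gamma> m)\<bar>"
      by blast
    have normFf: "norm (F + f) \<le> 4 - \<epsilon>"
    proof (rule lip0_norm_leI)
      fix x y
      let ?d = "\<lambda>g :: 'a lip0. \<bar>lip0_apply g x - lip0_apply g y\<bar>"
      have tri: "?d (F + f) \<le> ?d F + ?d f" by simp
      show "?d (F + f) \<le> (4 - \<epsilon>) * dist x y"
      proof (cases "dist x y < \<delta>")
        case True
        have "?d (F + f) \<le> \<epsilon> * dist x y + 2 * dist x y"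
          using tri \<delta>(2)[OF True] lip0_apply_diff_le[of f x y]
            mult_right_mono[OF f(2), of "dist x y"] by simp
        also have "\<dots> = (2 + \<epsilon>) * dist x y" by (simp add: algebra_simps)
        also have "\<dots> \<le> (4 - \<epsilon>) * dist x y" using \<epsilon> by (intro mult_right_mono) auto
        finally show ?thesis .
      next
        case False
        have "\<eta>' \<le> \<epsilon> * \<delta> / 2" by (simp add: \<eta>'_def)
        then have "?d f \<le> \<epsilon> * \<delta>" using f(3)[of x] f(3)[of y] by linarith
        also have "\<dots> \<le> \<epsilon> * dist x y" using False \<epsilon> by simp
        finally have "?d (F + f) \<le> (4 - 2 * \<epsilon>) * dist x y + \<epsilon> * dist x y"
          using tri lip0_apply_diff_le[of F x y] mult_right_mono[OF F(2), of "dist x y"] by simp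
        then show ?thesis by (simp add: algebra_simps)
      qed
    qed (use \<epsilon> in simp)
    obtain K where K: "0 \<le> K"
      "\<And>f r. (\<And>x. \<bar>lip0_apply f x\<bar> \<le> r) \<Longrightarrow> \<bar>lip_pairing f (\<gamma> m)\<bar> \<le> K * r"
      using fin[of m] unfolding finitely_supported_def by blast
    \<comment> \<open>Halving makes the allowances summable. The other bound gives
      \<open>K * (2 * \<theta>) \<le> c / 4\<close>, and \<open>K + 1\<close> avoids division by
      zero.\<close>
    define \<theta> where "\<theta> = min (\<eta> / 2) (c / (8 * (K + 1)))"
    have \<theta>: "0 < \<theta>" using \<eta> assms(1) K(1) by (simp add: \<theta>_def)
    have \<theta>_le: "\<theta> \<le> \<eta> / 2" unfolding \<theta>_def by (rule min.cobounded1)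
    have "K * (2 * \<theta>) \<le> (K + 1) * (2 * (c / (8 * (K + 1))))"
      using K(1) \<theta> by (intro mult_mono) (auto simp: \<theta>_def)
    also have "\<dots> = c / 4" using K(1) by (simp add: divide_simps)
    finally have "\<forall>f. (\<forall>x. \<bar>lip0_apply f x\<bar> \<le> 2 * \<theta>) \<longrightarrow> \<bar>lip_pairing f (\<gamma> m)\<bar> \<le> c / 4"
      using K(2) order_trans by blast
    moreover have "\<forall>x. \<bar>lip0_apply (F + f) x - lip0_apply F x\<bar> \<le> \<eta>"
      using f(3) by (simp add: \<eta>'_def)
    ultimately have "P (Suc k) (F + f, m, \<theta>) \<and> Q s (F + f, m, \<theta>)"
      using F(1) f(1,4) normFf \<theta> \<theta>_le m N
      by (auto simp: P_def Q_def s \<epsilon>_def little_lip0_add less_imp_le)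
    then show ?thesis by blast
  qed
  obtain s where s: "\<And>k. P k (s k)" "\<And>k. Q (s k) (s (Suc k))"
    using dependent_nat_choice[of P "\<lambda>_. Q"] P0 PQ by blast
  define F nn \<eta> where "F = (\<lambda>k. fst (s k))" and "nn = (\<lambda>k. fst (snd (s k)))"
    and "\<eta> = (\<lambda>k. snd (snd (s k)))"
  have sk: "s k = (F k, nn k, \<eta> k)" for k by (simp add: \<eta>_def F_def nn_def)
  have P: "norm (F k) \<le> 4 - 2 * (1/2)^k" "0 < \<eta> k" for k
    using s(1)[of k] by (auto simp: sk P_def)
  have normF: "norm (F k) \<le> 4" for k
    using P(1)[of k] zero_le_power[of "1/2::real" k] by linarith
  have Q: "nn k < nn (Suc k)" "\<eta> (Suc k) \<le> \<eta> k / 2"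
    "\<bar>lip0_apply (F (Suc k)) x - lip0_apply (F k) x\<bar> \<le> \<eta> k"
    "\<bar>lip_pairing (F k) (\<gamma> (nn (Suc k)))\<bar> \<le> c / 4"
    "c \<le> \<bar>lip_pairing (F (Suc k) - F k) (\<gamma> (nn (Suc k)))\<bar>"
    "(\<And>x. \<bar>lip0_apply f x\<bar> \<le> 2 * \<eta> (Suc k)) \<Longrightarrow> \<bar>lip_pairing f (\<gamma> (nn (Suc k)))\<bar> \<le> c / 4" for k x f
    using s(2)[of k] by (auto simp: sk Q_def)
  have tail: "\<bar>lip0_apply (F j) x - lip0_apply (F k) x\<bar> \<le> 2 * \<eta> k" if "k \<le> j" for j k x
  proof -
    \<comment> \<open>Strengthened for the induction: each increment is at most
      \<open>\<eta> j\<close>, hence at most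
      \<open>2 * \<eta> j - 2 * \<eta> (Suc j)\<close>.\<close>
    have "\<bar>lip0_apply (F j) x - lip0_apply (F k) x\<bar> \<le> 2 * \<eta> k - 2 * \<eta> j"
      using that
    proof (induction rule: dec_induct)
      case (step j)
      then show ?case using Q(2)[of j] Q(3)[of j x] by simp
    qed simp
    then show ?thesis using P(2)[of j] by simp
  qed
  have \<eta>_le: "\<eta> k \<le> \<eta> 0 * (1/2)^k" for k
  proof (induction k)
    case (Suc k)
    then show ?case using Q(2)[of k] by simp
  qed simp
  have lim: "(\<lambda>k. 2 * (\<eta> 0 * (1/2)^k)) \<longlonglongrightarrow> 2 * (\<eta> 0 * 0)"
    by (intro tendsto_intros LIMSEQ_power_zero) simp
  have small: "\<exists>k. 2 * \<eta> k < r" if "0 < r" for r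
  proof -
    have "\<forall>\<^sub>F k in sequentially. 2 * (\<eta> 0 * (1/2)^k) < r"
      using that by (intro order_tendstoD(2)[OF lim]) simp
    then obtain k where "2 * (\<eta> 0 * (1/2)^k) < r"
      using eventually_sequentially by auto
    then show ?thesis using \<eta>_le[of k] by (intro exI[of _ k]) linarith
  qed
  have "convergent (\<lambda>k. lip0_apply (F k) x)" for x
  proof (rule Cauchy_convergent, rule metric_CauchyI)
    fix r :: real assume "0 < r"
    then obtain k where k: "2 * \<eta> k < r / 2" using small[of "r / 2"] by auto
    have "dist (lip0_apply (F i) x) (lip0_apply (F j) x) < r" if "i \<ge> k" "j \<ge> k" for i j
      using tail[OF that(1), of x] tail[OF that(2), of x] k by (simp add: dist_real_def)
    then show "\<exists>M. \<forall>i\<ge>M. \<forall>j\<ge>M. dist (lip0_apply (F i) x) (lip0_apply (F j) x) < r"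
      by blast
  qed
  with normF obtain H where H: "\<And>x. (\<lambda>k. lip0_apply (F k) x) \<longlonglongrightarrow> lip0_apply H x"
    by (rule lip0_pointwise_limit) blast
  have "\<bar>lip0_apply H x - lip0_apply (F k) x\<bar> \<le> 2 * \<eta> k" for x k
  proof (rule LIMSEQ_le_const2)
    show "(\<lambda>j. \<bar>lip0_apply (F j) x - lip0_apply (F k) x\<bar>) \<longlonglongrightarrow> \<bar>lip0_apply H x - lip0_apply (F k) x\<bar>"
      by (intro tendsto_intros H)
  qed (use tail in blast)
  then have "\<bar>lip_pairing (H - F (Suc k)) (\<gamma> (nn (Suc k)))\<bar> \<le> c / 4" for k
    by (intro Q(6)) simp
  then show False
    using no_humps[of c nn F H] Q(1,4,5) assms(1) by simp
qed

end

section \<open>Producing small flat humps from the norming condition\<close>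

text \<open>On \<open>E\<close> the values are bounded, so rounding them to a grid of width \<delta>
  leaves finitely many patterns. Choosing representatives inside \<open>B\<close> keeps the net
  within the locally flat functions when it is applied.\<close>

lemma finite_net_on_finite_set:
  fixes B :: "'a::pointed_metric_space lip0 set"
  assumes "finite E" and "0 < \<delta>" and "\<And>f. f \<in> B \<Longrightarrow> norm f \<le> 1"
  obtains G where "finite G" and "G \<subseteq> B"
    and "\<And>f. f \<in> B \<Longrightarrow> \<exists>g\<in>G. \<forall>a\<in>E. \<bar>lip0_apply f a - lip0_apply g a\<bar> \<le> \<delta>"
proof -
  define q where "q = (\<lambda>f. restrict (\<lambda>a. \<lfloor>lip0_apply f a / \<delta>\<rfloor>) E)"
  have "q ` B \<subseteq> (\<Pi>\<^sub>E a\<in>E. {\<lfloor>- dist a basepoint / \<delta>\<rfloor>..\<lfloor>dist a basepoint / \<delta>\<rfloor>})"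
  proof (clarsimp simp: q_def)
    fix f a assume "f \<in> B"
    then have "\<bar>lip0_apply f a\<bar> \<le> dist a basepoint"
      using lip0_abs_le[of f a] mult_right_mono[OF assms(3)[of f], of "dist a basepoint"] by simp
    then show "\<lfloor>- (dist a basepoint / \<delta>)\<rfloor> \<le> \<lfloor>lip0_apply f a / \<delta>\<rfloor> \<and>
        \<lfloor>lip0_apply f a / \<delta>\<rfloor> \<le> \<lfloor>dist a basepoint / \<delta>\<rfloor>"
      using assms(2) by (auto intro!: floor_mono simp: field_simps)
  qed
  then have "finite (q ` B)"
    by (rule finite_subset) (intro finite_PiE assms(1) finite_atLeastAtMost_int)
  then obtain G where G: "G \<subseteq> B" "finite G" "q ` B = q ` G"
    using finite_subset_image[of "q ` B" q B] by auto
  have "\<exists>g\<in>G. \<forall>a\<in>E. \<bar>lip0_apply f a - lip0_apply g a\<bar> \<le> \<delta>" if "f \<in> B" for f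
  proof -
    have "q f \<in> q ` G" using that G(3) by blast
    then obtain g where g: "g \<in> G" "q f = q g" by blast
    have "\<bar>lip0_apply f a - lip0_apply g a\<bar> \<le> \<delta>" if "a \<in> E" for a
    proof -
      have "\<lfloor>lip0_apply f a / \<delta>\<rfloor> = \<lfloor>lip0_apply g a / \<delta>\<rfloor>"
        using fun_cong[OF g(2), of a] that by (simp add: q_def)
      then have "\<bar>lip0_apply f a / \<delta> - lip0_apply g a / \<delta>\<bar> \<le> 1" by linarith
      then show ?thesis
        using assms(2) by (simp add: abs_le_iff field_simps)
    qed
    then show ?thesis using g(1) by blast
  qed
  then show thesis using that G by blast
qed

text \<open>The supremum need not be attained; giving away a factor 2 makes the inequality strict,
  so some function satisfies it.\<close>

lemma lip0_norming_witness:
  fixes \<gamma> :: "'a::pointed_metric_space lip_free"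
  assumes "lip0_norming TYPE('a) C" and "0 < C" and "0 < norm \<gamma>"
  obtains f :: "'a lip0" where "f \<in> little_lip0" and "norm f \<le> 1"
    and "norm \<gamma> \<le> 2 * C * \<bar>lip_pairing f \<gamma>\<bar>"
proof -
  define B :: "'a lip0 set" where "B = {f \<in> little_lip0. norm f \<le> 1}"
  have "norm \<gamma> / (2 * C) < norm \<gamma> / C" using assms(2,3) by (simp add: field_simps)
  also have "\<dots> \<le> (SUP f\<in>B. \<bar>lip_pairing f \<gamma>\<bar>)"
    using assms(1,2) by (simp add: lip0_norming_def B_def field_simps)
  finally have "norm \<gamma> / (2 * C) < (SUP f\<in>B. \<bar>lip_pairing f \<gamma>\<bar>)" .
  moreover have "B \<noteq> {}" using little_lip0_zero by (auto simp: B_def intro!: exI[of _ 0])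
  ultimately obtain f where "f \<in> B" "norm \<gamma> / (2 * C) < \<bar>lip_pairing f \<gamma>\<bar>"
    by (metis (no_types, lifting) less_cSupE image_iff image_is_empty)
  then show thesis using that assms(2) by (auto simp: B_def field_simps)
qed

context null_sequence
begin

text \<open>A norming \<open>f\<close> need not be small, but a net element \<open>g\<close> close
  to it on \<open>E\<close> pairs weakly with \<open>\<gamma> n\<close>. Then \<open>f - g\<close>
  is small near \<open>E\<close>, and clamping it changes values only where tightness makes the
  change cheap.\<close>

lemma flat_hump:
  assumes "lip0_norming TYPE('a) C" and "0 < C" and "0 < e" and "\<And>n. e \<le> norm (\<gamma> n)" and "0 < \<eta>"
  shows "\<exists>n\<ge>N. \<exists>f\<in>little_lip0. norm f \<le> 2 \<and>
      (\<forall>x. \<bar>lip0_apply f x\<bar> \<le> \<eta>) \<and> e / (4 * C) \<le> \<bar>lip_pairing f (\<gamma> n)\<bar>"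
proof -
  \<comment> \<open>Norming gives \<open>8 * c\<close>; subtracting \<open>g\<close> costs less than
    \<open>c\<close> and clamping at most \<open>2 * c\<close>, leaving more than
    \<open>4 * c = e / (4 * C)\<close>.\<close>
  define c where "c = e / (16 * C)"
  have c: "0 < c" using assms by (simp add: c_def)
  \<comment> \<open>Radius and net width: near \<open>E\<close> the difference is at most
    \<open>\<eta> / 3\<close> from the net plus \<open>2 * (\<eta> / 3)\<close> from its Lipschitz
    constant 2.\<close>
  have \<delta>: "0 < \<eta> / 3" using assms by simp
  obtain E M where E: "finite E" and M: "\<And>n f. n \<ge> M \<Longrightarrow> norm f \<le> 1 \<Longrightarrow>
      (\<And>x. x \<in> (\<Union>a\<in>E. cball a (\<eta> / 3)) \<Longrightarrow> lip0_apply f x = 0) \<Longrightarrow> \<bar>lip_pairing f (\<gamma> n)\<bar> \<le> c / 2"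
  proof -
    have "0 < c / 2" using c by simp
    from tight_finite_nbhd[OF this \<delta>] obtain E M where "finite E" and "\<forall>n\<ge>M. \<forall>f. norm f \<le> 1 \<longrightarrow>
        (\<forall>x\<in>(\<Union>a\<in>E. cball a (\<eta> / 3)). lip0_apply f x = 0) \<longrightarrow> \<bar>lip_pairing f (\<gamma> n)\<bar> \<le> c / 2"
      by blast
    then show thesis by (intro that[of E M]) blast+
  qed
  \<comment> \<open>The net precedes the choice of \<open>n\<close>, so one index can be late for
    all its members; \<open>f\<close> is chosen only afterwards.\<close>
  obtain G where G: "finite G" "G \<subseteq> {f \<in> little_lip0. norm f \<le> 1}"
    "\<And>f. f \<in> {f \<in> little_lip0. norm f \<le> 1} \<Longrightarrow>
      \<exists>g\<in>G. \<forall>a\<in>E. \<bar>lip0_apply f a - lip0_apply g a\<bar> \<le> \<eta> / 3"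
    using finite_net_on_finite_set[OF E \<delta>, of "{f \<in> little_lip0. norm f \<le> 1}"] by auto
  have "\<forall>g\<in>G. \<forall>\<^sub>F n in sequentially. \<bar>lip_pairing g (\<gamma> n)\<bar> < c"
    using eventually_small[OF c] by (simp add: eventually_sequentially)
  then have "\<forall>\<^sub>F n in sequentially. \<forall>g\<in>G. \<bar>lip_pairing g (\<gamma> n)\<bar> < c"
    using G(1) by (simp add: eventually_ball_finite)
  then obtain N' where N': "\<And>n g. n \<ge> N' \<Longrightarrow> g \<in> G \<Longrightarrow> \<bar>lip_pairing g (\<gamma> n)\<bar> < c"
    unfolding eventually_sequentially by blast
  define n where "n = max N (max M N')"
  have n: "n \<ge> N" "n \<ge> M" "n \<ge> N'" by (auto simp: n_def)
  obtain f where f: "f \<in> little_lip0" "norm f \<le> 1" "norm (\<gamma> n) \<le> 2 * C * \<bar>lip_pairing f (\<gamma> n)\<bar>"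
  proof -
    have "0 < norm (\<gamma> n)" using assms(3) assms(4)[of n] by linarith
    from lip0_norming_witness[OF assms(1,2) this] show thesis using that by blast
  qed
  have f8: "8 * c \<le> \<bar>lip_pairing f (\<gamma> n)\<bar>"
    using f(3) assms(4)[of n] assms(2) by (simp add: c_def field_simps)
  obtain g where g: "g \<in> G" "\<And>a. a \<in> E \<Longrightarrow> \<bar>lip0_apply f a - lip0_apply g a\<bar> \<le> \<eta> / 3"
    using G(3)[of f] f by blast
  then have g': "g \<in> little_lip0" "norm g \<le> 1" using G(2) by auto
  have nfg: "norm (f - g) \<le> 2" using norm_triangle_ineq4[of f g] f(2) g'(2) by simp
  obtain h where h: "norm h \<le> 2"
    "\<And>x. lip0_apply h x = max (- \<eta>) (min \<eta> (lip0_apply (f - g) x))"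
    using lip0_clamp[OF nfg, of "\<lambda>_. \<eta>"] assms(5) by auto
  have "h \<in> little_lip0"
    by (rule little_lip0_clamp[OF little_lip0_diff[OF f(1) g'(1)] h(2)])
  moreover have "\<forall>x. \<bar>lip0_apply h x\<bar> \<le> \<eta>" using assms(5) by (auto simp: h(2))
  moreover have "\<bar>lip_pairing ((1/4) *\<^sub>R (f - g - h)) (\<gamma> n)\<bar> \<le> c / 2"
  proof (rule M[OF n(2)])
    show "norm ((1/4) *\<^sub>R (f - g - h)) \<le> 1"
      using norm_triangle_ineq4[of "f - g" h] nfg h(1) by simp
    fix x :: 'a assume "x \<in> (\<Union>a\<in>E. cball a (\<eta> / 3))"
    then obtain a where a: "a \<in> E" "dist a x \<le> \<eta> / 3" by auto
    have "norm (f - g) * dist x a \<le> 2 * (\<eta> / 3)"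
      using nfg a(2) by (intro mult_mono) (auto simp: dist_commute)
    then have "\<bar>lip0_apply (f - g) x - lip0_apply (f - g) a\<bar> \<le> 2 * (\<eta> / 3)"
      using lip0_apply_diff_le[of "f - g" x a] by linarith
    then have "\<bar>lip0_apply (f - g) x\<bar> \<le> \<eta>"
      using g(2)[OF a(1)] unfolding lip0_apply_diff by linarith
    then show "lip0_apply ((1/4) *\<^sub>R (f - g - h)) x = 0"
      by (auto simp: h(2))
  qed
  then have "e / (4 * C) \<le> \<bar>lip_pairing h (\<gamma> n)\<bar>"
    using f8 N'[OF n(3) g(1)] c
    by (simp add: lip_pairing_scaleR lip_pairing_diff c_def)
  ultimately show ?thesis using n(1) h(1) by blast
qed

end

section \<open>Reduction to finitely supported elements\<close>

theorem proposition4p1: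
  fixes C :: real
  assumes "C \<ge> 1"
    and "lip0_norming TYPE('a::pointed_metric_space) C"
  shows "schur_property TYPE('a lip_free)"
  unfolding schur_property_def
proof (intro allI impI, rule ccontr)
  fix x :: "nat \<Rightarrow> 'a lip_free"
  assume wn: "weakly_null x" and "\<not> x \<longlonglongrightarrow> 0"
  then obtain e where e: "0 < e" "\<And>N. \<exists>n\<ge>N. e \<le> norm (x n)"
    unfolding LIMSEQ_iff by (auto simp: not_less)
  \<comment> \<open>\<open>r\<close> may repeat values; \<open>r k \<ge> k\<close> already makes it
    tend to infinity.\<close>
  define r where "r = (\<lambda>k. SOME n. n \<ge> k \<and> e \<le> norm (x n))"
  have r: "r k \<ge> k \<and> e \<le> norm (x (r k))" for k
    unfolding r_def using e(2) by (rule someI_ex)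
  have "filterlim r at_top sequentially"
    using r by (intro filterlim_at_top_mono[OF filterlim_ident]) auto
  \<comment> \<open>The bound \<open>e / 2\<close> keeps the norms at least \<open>e / 2\<close>;
    the other makes the perturbation norm null, which preserves null pairings.\<close>
  have "\<exists>\<mu>. finitely_supported \<mu> \<and> norm (x (r k) - \<mu>) < min (e / 2) (inverse (real (Suc k)))" for k
    using finitely_supported_dense[of "min (e / 2) (inverse (real (Suc k)))" "x (r k)"] e(1) by auto
  then obtain \<mu> where \<mu>: "\<And>k. finitely_supported (\<mu> k)"
    "\<And>k. norm (x (r k) - \<mu> k) < min (e / 2) (inverse (real (Suc k)))"
    by metis
  have "(\<lambda>k. norm (x (r k) - \<mu> k)) \<longlonglongrightarrow> 0"
    by (rule tendsto_sandwich[OF _ _ tendsto_const LIMSEQ_inverse_real_of_nat])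
      (use \<mu>(2) in \<open>auto simp: less_imp_le\<close>)
  then have x\<mu>: "(\<lambda>k. x (r k) - \<mu> k) \<longlonglongrightarrow> 0"
    by (rule tendsto_norm_zero_cancel)
  have "(\<lambda>k. lip_pairing f (\<mu> k)) \<longlonglongrightarrow> 0" for f
  proof -
    interpret bounded_linear "lip_pairing f" by (rule bounded_linear_lip_pairing)
    have "(\<lambda>k. lip_pairing f (x (r k)) - lip_pairing f (x (r k) - \<mu> k)) \<longlonglongrightarrow> 0 - 0"
      using filterlim_compose[OF weakly_null_lip_pairing[OF wn] \<open>filterlim r at_top sequentially\<close>]
        tendsto_zero[OF x\<mu>]
      by (rule tendsto_diff)
    then show ?thesis by (simp add: diff)
  qed
  then interpret null_sequence \<mu>
    using \<mu>(1) by unfold_locales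
  have "e / 2 \<le> norm (\<mu> k)" for k
    using norm_triangle_ineq2[of "x (r k)" "x (r k) - \<mu> k"] \<mu>(2)[of k] r[of k] by simp
  then have "\<exists>n\<ge>N. \<exists>f\<in>little_lip0. norm f \<le> 2 \<and>
      (\<forall>x. \<bar>lip0_apply f x\<bar> \<le> \<eta>) \<and> e / 2 / (4 * C) \<le> \<bar>lip_pairing f (\<mu> n)\<bar>" if "0 < \<eta>" for \<eta> N
    using flat_hump[OF assms(2), of "e / 2" \<eta> N] assms(1) e(1) that by simp
  then show False
    using no_flat_humps[of "e / 2 / (4 * C)"] assms(1) e(1) by simp
qed

end
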